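(* Let $V$ be a variety in a language $L$, and consider presentations with a fixed generating tuple $\bar a$ and $k$ identities. Let $L'$ be the result of adding to $L$ constants for the generators $\bar a$. Let $T_F$ be the set of $L'$-sentences true in the free structure $F$ generated by $\bar a$, and let $S$ be the set of $L'$-sentences with limiting density $1$. Then the following are equivalent: (1) $T_F\subseteq S$; (2) $T_F=S$; (3) $S$ has the following two properties: (a) $S$ includes the sentences from $T_F$ of the form $t(\bar a)\ne t'(\bar a)$; (b) for any $L'$-formula $\varphi(x)$ with just $x$ free, if $\varphi(t(\bar a))\in S$ for all closed terms $t(\bar a)$, then $(\forall x)\varphi(x)\in S$.
   Context: The language $L$ is algebraic (only function symbols and constants). A variety is a class of $L$-structures axiomatized by universally quantified equations; $T$ is the theory generated by the axioms. A presentation $\bar a|R$ consists of the fixed tuple $\bar a$ of generators and an unordered set $R$ of $k$ distinct identities $t(\bar a)=t'(\bar a)$ drawn from a fixed class of allowable identities, each having a length in $\mathbb{N}$, with only finitely many allowable identities of each length (and at least one allowable presentation with identities of length at most $s$ for all large $s$). $\langle\bar a|R\rangle$ is the member of $V$ generated by $\bar a$ in which the equations between closed terms in $\bar a$ that hold are exactly those that follow logically from $T\cup R$; the new constants of $L'$ are interpreted as the generators. The free structure $F$ is the one given by the empty set of identities. $P_s$ is the number of presentations in which all identities have length at most $s$, and $P_s(\varphi)$ is the number of these for which $\langle\bar a|R\rangle\models\varphi$. A sentence $\varphi$ has limiting density $d$ if $\lim_{s\to\infty}P_s(\varphi)/P_s=d$. *)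

theory Defs
  imports Complex_Main
begin

section \<open>Algebraic languages, terms and formulas\<close>

record 'f lang =
  syms :: "'f set"
  arity :: "'f \<Rightarrow> nat"

datatype (funs_trm: 'f, vars_trm: 'v) trm = Var 'v | Fn 'f "('f, 'v) trm list"

fun wf_trm :: "'f lang \<Rightarrow> ('f, 'v) trm \<Rightarrow> bool" where
  "wf_trm G (Var x) \<longleftrightarrow> True"
| "wf_trm G (Fn f ts) \<longleftrightarrow> f \<in> syms G \<and> length ts = arity G f \<and> (\<forall>t \<in> set ts. wf_trm G t)"

definition closed_terms :: "'f lang \<Rightarrow> ('f, nat) trm set" where
  "closed_terms G = {t. wf_trm G t \<and> vars_trm t = {}}"

fun subst_trm :: "('v \<Rightarrow> ('f, 'w) trm) \<Rightarrow> ('f, 'v) trm \<Rightarrow> ('f, 'w) trm" where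
  "subst_trm \<sigma> (Var x) = \<sigma> x"
| "subst_trm \<sigma> (Fn f ts) = Fn f (map (subst_trm \<sigma>) ts)"

datatype 'f fm =
    Eq "('f, nat) trm" "('f, nat) trm"
  | Neg "'f fm"
  | And "'f fm" "'f fm"
  | All nat "'f fm"

fun wf_fm :: "'f lang \<Rightarrow> 'f fm \<Rightarrow> bool" where
  "wf_fm G (Eq s t) \<longleftrightarrow> wf_trm G s \<and> wf_trm G t"
| "wf_fm G (Neg \<phi>) \<longleftrightarrow> wf_fm G \<phi>"
| "wf_fm G (And \<phi> \<psi>) \<longleftrightarrow> wf_fm G \<phi> \<and> wf_fm G \<psi>"
| "wf_fm G (All x \<phi>) \<longleftrightarrow> wf_fm G \<phi>"

fun free_vars :: "'f fm \<Rightarrow> nat set" where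
  "free_vars (Eq s t) = vars_trm s \<union> vars_trm t"
| "free_vars (Neg \<phi>) = free_vars \<phi>"
| "free_vars (And \<phi> \<psi>) = free_vars \<phi> \<union> free_vars \<psi>"
| "free_vars (All x \<phi>) = free_vars \<phi> - {x}"

definition sentences :: "'f lang \<Rightarrow> 'f fm set" where
  "sentences G = {\<phi>. wf_fm G \<phi> \<and> free_vars \<phi> = {}}"

text \<open>The instance \<open>\<phi>(t)\<close> obtained by replacing the free occurrences of \<open>x\<close>.  It is only
  used for closed \<open>t\<close>, so no renaming of bound variables is needed.\<close>

fun inst_fm :: "nat \<Rightarrow> ('f, nat) trm \<Rightarrow> 'f fm \<Rightarrow> 'f fm" where
  "inst_fm x t (Eq u v) = Eq (subst_trm (Var(x := t)) u) (subst_trm (Var(x := t)) v)"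
| "inst_fm x t (Neg \<phi>) = Neg (inst_fm x t \<phi>)"
| "inst_fm x t (And \<phi> \<psi>) = And (inst_fm x t \<phi>) (inst_fm x t \<psi>)"
| "inst_fm x t (All y \<phi>) = All y (if y = x then \<phi> else inst_fm x t \<phi>)"

section \<open>Structures and satisfaction\<close>

record ('f, 'a) struct =
  universe :: "'a set"
  intp :: "'f \<Rightarrow> 'a list \<Rightarrow> 'a"

definition is_struct :: "'f lang \<Rightarrow> ('f, 'a) struct \<Rightarrow> bool" where
  "is_struct G M \<longleftrightarrow>
    (\<forall>f \<in> syms G. \<forall>as. length as = arity G f \<and> set as \<subseteq> universe M \<longrightarrow> intp M f as \<in> universe M)"

fun eval :: "('f, 'a) struct \<Rightarrow> ('v \<Rightarrow> 'a) \<Rightarrow> ('f, 'v) trm \<Rightarrow> 'a" where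
  "eval M e (Var x) = e x"
| "eval M e (Fn f ts) = intp M f (map (eval M e) ts)"

fun sat :: "('f, 'a) struct \<Rightarrow> (nat \<Rightarrow> 'a) \<Rightarrow> 'f fm \<Rightarrow> bool" where
  "sat M e (Eq s t) \<longleftrightarrow> eval M e s = eval M e t"
| "sat M e (Neg \<phi>) \<longleftrightarrow> \<not> sat M e \<phi>"
| "sat M e (And \<phi> \<psi>) \<longleftrightarrow> sat M e \<phi> \<and> sat M e \<psi>"
| "sat M e (All x \<phi>) \<longleftrightarrow> (\<forall>a \<in> universe M. sat M (e(x := a)) \<phi>)"

text \<open>Truth of sentences.  The value of \<open>sat M e \<phi>\<close> does not depend on \<open>e\<close> when \<open>\<phi>\<close> is a sentence;
  \<open>e\<close> is not restricted to the domain because the domain may be empty (this happens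
  only for languages without closed terms).\<close>

definition models :: "('f, 'a) struct \<Rightarrow> 'f fm \<Rightarrow> bool" where
  "models M \<phi> \<longleftrightarrow> (\<forall>e. sat M e \<phi>)"

section \<open>Varieties\<close>

definition identities :: "'f lang \<Rightarrow> (('f, nat) trm \<times> ('f, nat) trm) set" where
  "identities L = {(s, t). wf_trm L s \<and> wf_trm L t}"

definition variety :: "'f lang \<Rightarrow> (('f, nat) trm \<times> ('f, nat) trm) set \<Rightarrow> ('f, 'a) struct set" where
  "variety L E = {M. is_struct L M \<and>
     (\<forall>(s, t) \<in> E. \<forall>e. range e \<subseteq> universe M \<longrightarrow> eval M e s = eval M e t)}"

section \<open>Presentations\<close>

text \<open>The language \<open>L'\<close>, which adds to \<open>L\<close> a constant \<open>Inr i\<close> for each of the \<open>n\<close> generators;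
  hence the terms \<open>t(a)\<close> in the generators are exactly the closed terms of \<open>L'\<close>.\<close>

definition expand :: "'f lang \<Rightarrow> nat \<Rightarrow> ('f + nat) lang" where
  "expand L n = \<lparr>syms = Inl ` syms L \<union> Inr ` {..<n}, arity = case_sum (arity L) (\<lambda>_. 0)\<rparr>"

definition reduct :: "('f + nat, 'a) struct \<Rightarrow> ('f, 'a) struct" where
  "reduct M = \<lparr>universe = universe M, intp = (\<lambda>f. intp M (Inl f))\<rparr>"

type_synonym 'f cterm = "('f + nat, nat) trm"
type_synonym 'f identity = "'f cterm \<times> 'f cterm"

definition closed_identities :: "'f lang \<Rightarrow> nat \<Rightarrow> 'f identity set" where
  "closed_identities L n = closed_terms (expand L n) \<times> closed_terms (expand L n)"

definition model_of ::
  "'f lang \<Rightarrow> (('f, nat) trm \<times> ('f, nat) trm) set \<Rightarrow> nat \<Rightarrow> 'f identity set \<Rightarrow> ('f + nat, 'a) struct \<Rightarrow> bool"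
  where
  "model_of L E n R M \<longleftrightarrow> is_struct (expand L n) M \<and> reduct M \<in> variety L E \<and>
     (\<forall>(u, v) \<in> R. models M (Eq u v))"

text \<open>The closed equation \<open>s = t\<close> follows logically from \<open>T \<union> R\<close>.  A definition in HOL can only
  quantify over models with elements in a fixed type; the type of sets of terms is large
  enough, by lemma \<open>follows_any\<close> below.\<close>

definition follows ::
  "'f lang \<Rightarrow> (('f, nat) trm \<times> ('f, nat) trm) set \<Rightarrow> nat \<Rightarrow> 'f identity set \<Rightarrow> 'f cterm \<Rightarrow> 'f cterm \<Rightarrow> bool"
  where
  "follows L E n R s t \<longleftrightarrow>
     (\<forall>M :: ('f + nat, 'f cterm set) struct. model_of L E n R M \<longrightarrow> models M (Eq s t))"

definition eq_class :: "'g lang \<Rightarrow> (('g, nat) trm \<Rightarrow> ('g, nat) trm \<Rightarrow> bool) \<Rightarrow> ('g, nat) trm \<Rightarrow> ('g, nat) trm set"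
  where
  "eq_class G \<theta> t = {u \<in> closed_terms G. \<theta> t u}"

definition term_quotient ::
  "'g lang \<Rightarrow> (('g, nat) trm \<Rightarrow> ('g, nat) trm \<Rightarrow> bool) \<Rightarrow> ('g, ('g, nat) trm set) struct" where
  "term_quotient G \<theta> =
     \<lparr>universe = eq_class G \<theta> ` closed_terms G,
      intp = (\<lambda>f Cs. eq_class G \<theta> (Fn f (map (\<lambda>C. SOME t. t \<in> C) Cs)))\<rparr>"

text \<open>The \<open>L'\<close>-structure presented by the \<open>n\<close> generators and the identities \<open>R\<close>.  The lemmas
  \<open>presented_model\<close>, \<open>presented_generated\<close> and \<open>presented_eq_iff\<close> below show that it has the properties
  which determine it up to isomorphism.\<close>

definition presented ::
  "'f lang \<Rightarrow> (('f, nat) trm \<times> ('f, nat) trm) set \<Rightarrow> nat \<Rightarrow> 'f identity set \<Rightarrow> ('f + nat, 'f cterm set) struct"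
  where
  "presented L E n R = term_quotient (expand L n) (follows L E n R)"

definition free_structure ::
  "'f lang \<Rightarrow> (('f, nat) trm \<times> ('f, nat) trm) set \<Rightarrow> nat \<Rightarrow> ('f + nat, 'f cterm set) struct" where
  "free_structure L E n = presented L E n {}"

section \<open>Limiting density\<close>

definition presentations :: "nat \<Rightarrow> 'i set \<Rightarrow> ('i \<Rightarrow> nat) \<Rightarrow> nat \<Rightarrow> 'i set set" where
  "presentations k A len s = {R. R \<subseteq> A \<and> finite R \<and> card R = k \<and> (\<forall>i \<in> R. len i \<le> s)}"

definition has_limiting_density ::
  "'f lang \<Rightarrow> (('f, nat) trm \<times> ('f, nat) trm) set \<Rightarrow> nat \<Rightarrow> nat \<Rightarrow> 'f identity set \<Rightarrow> ('f identity \<Rightarrow> nat)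
   \<Rightarrow> ('f + nat) fm \<Rightarrow> real \<Rightarrow> bool" where
  "has_limiting_density L E n k A len \<phi> d \<longleftrightarrow>
     (\<lambda>s. real (card {R \<in> presentations k A len s. models (presented L E n R) \<phi>})
          / real (card (presentations k A len s))) \<longlonglongrightarrow> d"

definition free_theory ::
  "'f lang \<Rightarrow> (('f, nat) trm \<times> ('f, nat) trm) set \<Rightarrow> nat \<Rightarrow> ('f + nat) fm set" where
  "free_theory L E n = {\<phi> \<in> sentences (expand L n). models (free_structure L E n) \<phi>}"

definition density_one_sentences ::
  "'f lang \<Rightarrow> (('f, nat) trm \<times> ('f, nat) trm) set \<Rightarrow> nat \<Rightarrow> nat \<Rightarrow> 'f identity set \<Rightarrow> ('f identity \<Rightarrow> nat)
   \<Rightarrow> ('f + nat) fm set" where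
  "density_one_sentences L E n k A len =
     {\<phi> \<in> sentences (expand L n). has_limiting_density L E n k A len \<phi> 1}"

section \<open>The presented structure has its defining properties\<close>

lemma closed_terms_Fn:
  "Fn f ts \<in> closed_terms G \<longleftrightarrow>
     f \<in> syms G \<and> length ts = arity G f \<and> set ts \<subseteq> closed_terms G"
  by (auto simp: closed_terms_def)

lemma subst_closed:
  assumes "wf_trm G t" "\<And>x. x \<in> vars_trm t \<Longrightarrow> \<sigma> x \<in> closed_terms G"
  shows "subst_trm \<sigma> t \<in> closed_terms G"
  using assms by (induction t) (auto simp: closed_terms_Fn)

lemma eval_subst: "eval M e (subst_trm \<sigma> t) = eval M (\<lambda>x. eval M e (\<sigma> x)) t"
  by (induction t) (auto simp: comp_def intro!: arg_cong[where f = "intp M _"])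

lemma eval_closed:
  assumes "is_struct G M" "t \<in> closed_terms G"
  shows "eval M e t \<in> universe M"
  using assms(2)
proof (induction t)
  case (Var x)
  then show ?case by (simp add: closed_terms_def)
next
  case (Fn f ts)
  then have "set (map (eval M e) ts) \<subseteq> universe M" "f \<in> syms G" "length (map (eval M e) ts) = arity G f"
    by (auto simp: closed_terms_Fn subset_iff)
  then show ?case using assms(1) unfolding is_struct_def eval.simps by blast
qed

lemma eval_closed_indep:
  assumes "t \<in> closed_terms G"
  shows "eval M e t = eval M e' t"
  using assms
proof (induction t)
  case (Var x)
  then show ?case by (simp add: closed_terms_def)
next
  case (Fn f ts)
  then have "map (eval M e) ts = map (eval M e') ts"
    by (auto simp: closed_terms_Fn)
  then show ?case by (metis eval.simps(2))
qed

lemma models_Eq_closed: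
  assumes "s \<in> closed_terms G" "t \<in> closed_terms G"
  shows "models M (Eq s t) \<longleftrightarrow> eval M e s = eval M e t"
  using eval_closed_indep[OF assms(1), of M] eval_closed_indep[OF assms(2), of M]
  unfolding models_def by (metis sat.simps(1))

lemma eval_reduct: "eval (reduct M) e t = eval M e (map_trm Inl id t)"
  by (induction t) (auto simp: reduct_def comp_def intro!: arg_cong[where f = "intp M _"])

lemma wf_lift: "wf_trm L t \<Longrightarrow> wf_trm (expand L n) (map_trm Inl id t)"
  by (induction t) (auto simp: expand_def)

definition term_congruence :: "'g lang \<Rightarrow> (('g, nat) trm \<Rightarrow> ('g, nat) trm \<Rightarrow> bool) \<Rightarrow> bool" where
  "term_congruence G \<theta> \<longleftrightarrow>
     equivp \<theta> \<and>
     (\<forall>f ss ts. Fn f ss \<in> closed_terms G \<longrightarrow> Fn f ts \<in> closed_terms G \<longrightarrow> list_all2 \<theta> ss ts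
        \<longrightarrow> \<theta> (Fn f ss) (Fn f ts))"

lemma eq_class_eq_iff:
  assumes "term_congruence G \<theta>" "s \<in> closed_terms G" "t \<in> closed_terms G"
  shows "eq_class G \<theta> s = eq_class G \<theta> t \<longleftrightarrow> \<theta> s t"
proof -
  have "equivp \<theta>" using assms(1) by (simp add: term_congruence_def)
  then have "\<theta> t t" "\<And>u. \<theta> s t \<Longrightarrow> \<theta> s u \<longleftrightarrow> \<theta> t u"
    by (metis equivp_reflp, metis equivp_symp equivp_transp)
  then show ?thesis using assms(3) by (auto simp: eq_class_def)
qed

lemma eq_class_pick:
  assumes "term_congruence G \<theta>" "t \<in> closed_terms G"
  shows "(SOME u. u \<in> eq_class G \<theta> t) \<in> closed_terms G" "\<theta> t (SOME u. u \<in> eq_class G \<theta> t)"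
proof -
  have "t \<in> eq_class G \<theta> t"
    using assms by (auto simp: eq_class_def term_congruence_def intro: equivp_reflp)
  then have "(SOME u. u \<in> eq_class G \<theta> t) \<in> eq_class G \<theta> t" by (rule someI)
  then show "(SOME u. u \<in> eq_class G \<theta> t) \<in> closed_terms G"
    "\<theta> t (SOME u. u \<in> eq_class G \<theta> t)" by (auto simp: eq_class_def)
qed

lemma intp_term_quotient:
  assumes \<theta>: "term_congruence G \<theta>" and t: "Fn f ts \<in> closed_terms G"
  shows "intp (term_quotient G \<theta>) f (map (eq_class G \<theta>) ts) = eq_class G \<theta> (Fn f ts)"
proof -
  let ?us = "map (\<lambda>t. SOME u. u \<in> eq_class G \<theta> t) ts"
  have ts: "set ts \<subseteq> closed_terms G" using t by (simp add: closed_terms_Fn)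
  have u: "Fn f ?us \<in> closed_terms G"
    using t eq_class_pick(1)[OF \<theta>] by (auto simp: closed_terms_Fn)
  have "list_all2 \<theta> ts ?us"
    using ts eq_class_pick(2)[OF \<theta>] by (auto simp: list_all2_conv_all_nth subset_iff)
  then have "\<theta> (Fn f ts) (Fn f ?us)"
    using \<theta> t u by (auto simp: term_congruence_def)
  then have "eq_class G \<theta> (Fn f ts) = eq_class G \<theta> (Fn f ?us)"
    using eq_class_eq_iff[OF \<theta> t u] by simp
  then show ?thesis by (simp add: term_quotient_def comp_def)
qed

lemma eval_term_quotient:
  assumes \<theta>: "term_congruence G \<theta>" and "wf_trm G t"
    and "\<And>x. x \<in> vars_trm t \<Longrightarrow> \<sigma> x \<in> closed_terms G \<and> e x = eq_class G \<theta> (\<sigma> x)"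
  shows "eval (term_quotient G \<theta>) e t = eq_class G \<theta> (subst_trm \<sigma> t)"
  using assms(2,3)
proof (induction t)
  case (Var x)
  then show ?case by simp
next
  case (Fn f ts)
  have "map (eval (term_quotient G \<theta>) e) ts = map (eq_class G \<theta>) (map (subst_trm \<sigma>) ts)"
    using Fn by auto
  moreover have "subst_trm \<sigma> (Fn f ts) \<in> closed_terms G"
    by (rule subst_closed) (use Fn.prems in auto)
  ultimately show ?case
    using intp_term_quotient[OF \<theta>] by (metis eval.simps(2) subst_trm.simps(2))
qed

lemma subst_closed_id: "vars_trm t = {} \<Longrightarrow> subst_trm Var t = t"
  by (induction t) (auto intro: map_idI)

lemma eval_closed_term_quotient:
  assumes "term_congruence G \<theta>" "t \<in> closed_terms G"
  shows "eval (term_quotient G \<theta>) e t = eq_class G \<theta> t"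
  using eval_term_quotient[OF assms(1), of t Var e] assms(2)
  by (simp add: closed_terms_def subst_closed_id)

lemma is_struct_term_quotient:
  assumes \<theta>: "term_congruence G \<theta>"
  shows "is_struct G (term_quotient G \<theta>)"
  unfolding is_struct_def
proof (intro ballI allI impI)
  fix f as
  assume f: "f \<in> syms G" and as: "length as = arity G f \<and> set as \<subseteq> universe (term_quotient G \<theta>)"
  then have "as \<in> lists (eq_class G \<theta> ` closed_terms G)"
    by (auto simp: term_quotient_def)
  then obtain ts where ts: "as = map (eq_class G \<theta>) ts" "set ts \<subseteq> closed_terms G"
    unfolding lists_image by auto
  then have "Fn f ts \<in> closed_terms G"
    using f as by (auto simp: closed_terms_Fn)
  then show "intp (term_quotient G \<theta>) f as \<in> universe (term_quotient G \<theta>)"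
    using intp_term_quotient[OF \<theta>] ts(1) by (auto simp: term_quotient_def)
qed

lemma model_term_quotient:
  assumes \<theta>: "term_congruence (expand L n) \<theta>"
    and E: "E \<subseteq> identities L" and R: "R \<subseteq> closed_identities L n"
    and ax: "\<And>s t \<sigma>. (s, t) \<in> E \<Longrightarrow> range \<sigma> \<subseteq> closed_terms (expand L n) \<Longrightarrow>
               \<theta> (subst_trm \<sigma> (map_trm Inl id s)) (subst_trm \<sigma> (map_trm Inl id t))"
    and rel: "\<And>s t. (s, t) \<in> R \<Longrightarrow> \<theta> s t"
  shows "model_of L E n R (term_quotient (expand L n) \<theta>)"
proof -
  let ?G = "expand L n" and ?Q = "term_quotient (expand L n) \<theta>"
  have Q: "is_struct ?G ?Q" by (rule is_struct_term_quotient[OF \<theta>])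
  then have "is_struct L (reduct ?Q)"
    by (auto simp: is_struct_def reduct_def expand_def)
  moreover have "eval (reduct ?Q) e s = eval (reduct ?Q) e t"
    if st: "(s, t) \<in> E" and e: "range e \<subseteq> universe (reduct ?Q)" for s t e
  proof -
    have "\<exists>u. u \<in> closed_terms ?G \<and> e x = eq_class ?G \<theta> u" for x
      using e by (auto simp: reduct_def term_quotient_def)
    then obtain \<sigma> where \<sigma>: "\<And>x. \<sigma> x \<in> closed_terms ?G \<and> e x = eq_class ?G \<theta> (\<sigma> x)" by metis
    have wf: "wf_trm ?G (map_trm Inl id s)" "wf_trm ?G (map_trm Inl id t)"
      using st E by (auto simp: identities_def intro: wf_lift)
    have "\<theta> (subst_trm \<sigma> (map_trm Inl id s)) (subst_trm \<sigma> (map_trm Inl id t))"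
      using ax[OF st] \<sigma> by blast
    then have "eq_class ?G \<theta> (subst_trm \<sigma> (map_trm Inl id s)) = eq_class ?G \<theta> (subst_trm \<sigma> (map_trm Inl id t))"
      using \<sigma> wf by (simp add: eq_class_eq_iff[OF \<theta>] subst_closed)
    then show ?thesis
      using eval_term_quotient[OF \<theta> wf(1), of \<sigma> e] eval_term_quotient[OF \<theta> wf(2), of \<sigma> e] \<sigma>
      by (simp add: eval_reduct)
  qed
  moreover have "models ?Q (Eq s t)" if "(s, t) \<in> R" for s t
  proof -
    have "s \<in> closed_terms ?G" "t \<in> closed_terms ?G"
      using that R by (auto simp: closed_identities_def)
    then show ?thesis using rel[OF that]
      by (simp add: models_def eval_closed_term_quotient[OF \<theta>] eq_class_eq_iff[OF \<theta>])
  qed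
  ultimately show ?thesis using Q unfolding model_of_def variety_def by fastforce
qed

lemma kernel_congruence:
  "term_congruence G (\<lambda>s t. models M (Eq s t))"
proof -
  have "models M (Eq (Fn f ss) (Fn f ts))" if "list_all2 (\<lambda>s t. models M (Eq s t)) ss ts" for f ss ts
  proof -
    have "map (eval M e) ss = map (eval M e) ts" for e
      using that by (auto simp: models_def list_all2_conv_all_nth intro: nth_equalityI)
    then show ?thesis by (metis eval.simps(2) models_def sat.simps(1))
  qed
  then show ?thesis
    by (auto simp: term_congruence_def models_def intro!: equivpI reflpI sympI transpI)
qed

lemma axiom_instance:
  assumes M: "model_of L E n R M" and st: "(s, t) \<in> E"
    and \<sigma>: "range \<sigma> \<subseteq> closed_terms (expand L n)"
  shows "models M (Eq (subst_trm \<sigma> (map_trm Inl id s)) (subst_trm \<sigma> (map_trm Inl id t)))"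
proof -
  have "range (\<lambda>x. eval M e (\<sigma> x)) \<subseteq> universe (reduct M)" for e
    using M \<sigma> eval_closed[of "expand L n" M] by (auto simp: model_of_def reduct_def)
  then have "eval (reduct M) (\<lambda>x. eval M e (\<sigma> x)) s = eval (reduct M) (\<lambda>x. eval M e (\<sigma> x)) t" for e
    using M st unfolding model_of_def variety_def by fastforce
  then show ?thesis
    by (simp add: models_def eval_subst eval_reduct)
qed

lemma follows_any:
  fixes M :: "('f + nat, 'a) struct"
  assumes E: "E \<subseteq> identities L" and R: "R \<subseteq> closed_identities L n"
    and st: "s \<in> closed_terms (expand L n)" "t \<in> closed_terms (expand L n)"
    and f: "follows L E n R s t" and M: "model_of L E n R M"
  shows "models M (Eq s t)"
proof -
  let ?\<theta> = "\<lambda>s t. models M (Eq s t)"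
  have \<theta>: "term_congruence (expand L n) ?\<theta>" by (rule kernel_congruence)
  have "model_of L E n R (term_quotient (expand L n) ?\<theta>)"
    by (rule model_term_quotient[OF \<theta> E R axiom_instance[OF M]])
      (use M in \<open>auto simp: model_of_def\<close>)
  then have "models (term_quotient (expand L n) ?\<theta>) (Eq s t)"
    using f by (simp add: follows_def)
  then have "eq_class (expand L n) ?\<theta> s = eq_class (expand L n) ?\<theta> t"
    by (metis eval_closed_term_quotient[OF \<theta>] models_Eq_closed st)
  then show ?thesis using eq_class_eq_iff[OF \<theta> st] by simp
qed

lemma follows_congruence: "term_congruence (expand L n) (follows L E n R)"
proof -
  have "follows L E n R (Fn f ss) (Fn f ts)"
    if "Fn f ss \<in> closed_terms (expand L n)" "Fn f ts \<in> closed_terms (expand L n)"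
      "list_all2 (follows L E n R) ss ts" for f ss ts
    unfolding follows_def
  proof (intro allI impI)
    fix M :: "('a + nat, 'a cterm set) struct"
    assume "model_of L E n R M"
    then have "list_all2 (\<lambda>s t. models M (Eq s t)) ss ts"
      using that(3) by (auto simp: follows_def list_all2_conv_all_nth)
    then show "models M (Eq (Fn f ss) (Fn f ts))"
      using kernel_congruence[of "expand L n" M] that(1,2) by (auto simp: term_congruence_def)
  qed
  moreover have "equivp (follows L E n R)"
    by (auto simp: follows_def models_def intro!: equivpI reflpI sympI transpI)
  ultimately show ?thesis by (auto simp: term_congruence_def)
qed

lemma presented_model:
  assumes E: "E \<subseteq> identities L" and R: "R \<subseteq> closed_identities L n"
  shows "model_of L E n R (presented L E n R)"
  unfolding presented_def
  by (rule model_term_quotient[OF follows_congruence E R])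
    (auto simp: follows_def model_of_def intro: axiom_instance[unfolded model_of_def])

lemma presented_generated:
  "universe (presented L E n R) = eval (presented L E n R) e ` closed_terms (expand L n)"
proof -
  have "universe (presented L E n R) = eq_class (expand L n) (follows L E n R) ` closed_terms (expand L n)"
    by (simp add: presented_def term_quotient_def)
  also have "\<dots> = eval (presented L E n R) e ` closed_terms (expand L n)"
    unfolding presented_def
    by (rule image_cong) (simp_all add: eval_closed_term_quotient[OF follows_congruence])
  finally show ?thesis .
qed

lemma presented_eq_iff:
  assumes "s \<in> closed_terms (expand L n)" "t \<in> closed_terms (expand L n)"
  shows "models (presented L E n R) (Eq s t) \<longleftrightarrow> follows L E n R s t"
  using assms
  by (simp add: presented_def models_def eval_closed_term_quotient[OF follows_congruence]
      eq_class_eq_iff[OF follows_congruence])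

end

theory Submission
  imports Defs
begin

text \<open>Every presented structure is generated by the constants, so a universal sentence holds in it iff
  all its closed instances do. An induction on the complexity of a sentence then shows that the
  sentences decided by \<open>F\<close> are decided in the same way with density \<open>1\<close>: equations true in
  \<open>F\<close> hold in all presented structures, false equations are covered by (a), and true universal
  sentences by (b). A false universal sentence has a false closed instance. As \<open>T\<^sub>F\<close> is complete
  and \<open>S\<close> is consistent, \<open>T\<^sub>F \<subseteq> S\<close> already forces equality.\<close>

section \<open>Satisfaction of sentences and instantiation by closed terms\<close>

lemma eval_cong_vars:
  assumes "\<And>x. x \<in> vars_trm t \<Longrightarrow> e x = e' x"
  shows "eval M e t = eval M e' t"
  using assms
proof (induction t)
  case (Var x)
  then show ?case by simp
next
  case (Fn f ts)
  then have "map (eval M e) ts = map (eval M e') ts" by auto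
  then show ?case by (metis eval.simps(2))
qed

lemma sat_cong_free_vars:
  assumes "\<And>x. x \<in> free_vars \<phi> \<Longrightarrow> e x = e' x"
  shows "sat M e \<phi> = sat M e' \<phi>"
  using assms
proof (induction \<phi> arbitrary: e e')
  case (Eq s t)
  then show ?case using eval_cong_vars[of s e e' M] eval_cong_vars[of t e e' M] by simp
next
  case (Neg \<phi>)
  show ?case using Neg.IH[of e e'] Neg.prems by simp
next
  case (And \<phi> \<psi>)
  show ?case using And.IH(1)[of e e'] And.IH(2)[of e e'] And.prems by simp
next
  case (All x \<phi>)
  have "sat M (e(x := a)) \<phi> = sat M (e'(x := a)) \<phi>" for a
    by (rule All.IH) (use All.prems in auto)
  then show ?case by simp
qed

lemma models_sentence: "free_vars \<phi> = {} \<Longrightarrow> models M \<phi> \<longleftrightarrow> sat M e \<phi>"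
  unfolding models_def using sat_cong_free_vars[of \<phi>] by blast

text \<open>Since \<open>models\<close> quantifies over all assignments, negation commutes with it
  only because a sentence has the same value under each of them.\<close>

lemma models_Neg: "free_vars \<phi> = {} \<Longrightarrow> models M (Neg \<phi>) \<longleftrightarrow> \<not> models M \<phi>"
  using models_sentence[of "Neg \<phi>" M] models_sentence[of \<phi> M] by simp

lemma models_And: "models M (And \<phi> \<psi>) \<longleftrightarrow> models M \<phi> \<and> models M \<psi>"
  by (auto simp: models_def)

text \<open>Closedness of \<open>t\<close> excludes variable capture: rebinding \<open>y\<close>
  under a quantifier leaves the value of \<open>t\<close> unchanged. If \<open>y = x\<close>, the
  inner binding overrides the outer update.\<close>

lemma sat_inst_fm:
  assumes "t \<in> closed_terms G"
  shows "sat M e (inst_fm x t \<phi>) \<longleftrightarrow> sat M (e(x := eval M e t)) \<phi>"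
proof (induction \<phi> arbitrary: e)
  case (Eq u v)
  have "(\<lambda>y. eval M e ((Var(x := t)) y)) = e(x := eval M e t)" by auto
  then show ?case by (simp only: inst_fm.simps sat.simps eval_subst)
next
  case (All y \<phi>)
  have "eval M (e(y := a)) t = eval M e t" for a
    using assms by (rule eval_closed_indep)
  then show ?case
    by (cases "y = x") (simp_all only: inst_fm.simps sat.simps All if_True if_False refl
        fun_upd_upd fun_upd_twist[of y x] not_False_eq_True)
qed auto

lemma wf_trm_subst: "wf_trm G u \<Longrightarrow> (\<And>x. wf_trm G (\<sigma> x)) \<Longrightarrow> wf_trm G (subst_trm \<sigma> u)"
  by (induction u) auto

lemma vars_trm_subst: "vars_trm (subst_trm \<sigma> u) = (\<Union>x \<in> vars_trm u. vars_trm (\<sigma> x))"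
  by (induction u) auto

lemma wf_fm_inst: "wf_fm G \<phi> \<Longrightarrow> wf_trm G t \<Longrightarrow> wf_fm G (inst_fm x t \<phi>)"
  by (induction \<phi>) (auto intro!: wf_trm_subst)

lemma free_vars_inst: "vars_trm t = {} \<Longrightarrow> free_vars (inst_fm x t \<phi>) = free_vars \<phi> - {x}"
  by (induction \<phi>) (auto simp: vars_trm_subst split: if_splits)

lemma inst_sentence:
  "wf_fm G \<phi> \<Longrightarrow> free_vars \<phi> \<subseteq> {x} \<Longrightarrow> t \<in> closed_terms G \<Longrightarrow> inst_fm x t \<phi> \<in> sentences G"
  by (auto simp: sentences_def closed_terms_def wf_fm_inst free_vars_inst)

text \<open>Unlike \<open>size\<close>, this does not grow when a term is substituted.\<close>

primrec complexity :: "'f fm \<Rightarrow> nat" where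
  "complexity (Eq s t) = 0"
| "complexity (Neg \<phi>) = Suc (complexity \<phi>)"
| "complexity (And \<phi> \<psi>) = Suc (complexity \<phi> + complexity \<psi>)"
| "complexity (All x \<phi>) = Suc (complexity \<phi>)"

lemma complexity_inst [simp]: "complexity (inst_fm x t \<phi>) = complexity \<phi>"
  by (induction \<phi>) auto

section \<open>Truth in presented structures and in the free structure\<close>

lemma presented_models_All:
  assumes "free_vars \<phi> \<subseteq> {x}"
  shows "models (presented L E n R) (All x \<phi>) \<longleftrightarrow>
    (\<forall>t \<in> closed_terms (expand L n). models (presented L E n R) (inst_fm x t \<phi>))"
    (is "models ?M _ \<longleftrightarrow> _")
proof -
  \<comment> \<open>Both sides concern sentences, so one arbitrary assignment suffices. It need not
    take values in the universe, which may be empty; then both sides hold vacuously.\<close>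
  fix e :: "nat \<Rightarrow> ('a + nat, nat) trm set"
  have "models ?M (All x \<phi>) \<longleftrightarrow> sat ?M e (All x \<phi>)"
    by (rule models_sentence) (use assms in auto)
  also have "\<dots> \<longleftrightarrow> (\<forall>t \<in> closed_terms (expand L n). sat ?M (e(x := eval ?M e t)) \<phi>)"
    using presented_generated[of L E n R e] by auto
  also have "\<dots> \<longleftrightarrow> (\<forall>t \<in> closed_terms (expand L n). sat ?M e (inst_fm x t \<phi>))"
    by (auto simp: sat_inst_fm)
  also have "\<dots> \<longleftrightarrow> (\<forall>t \<in> closed_terms (expand L n). models ?M (inst_fm x t \<phi>))"
  proof (rule ball_cong[OF refl])
    fix t :: "'a cterm" assume "t \<in> closed_terms (expand L n)"
    then have "free_vars (inst_fm x t \<phi>) = {}"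
      using assms by (auto simp: closed_terms_def free_vars_inst)
    then show "sat ?M e (inst_fm x t \<phi>) \<longleftrightarrow> models ?M (inst_fm x t \<phi>)"
      using models_sentence by blast
  qed
  finally show ?thesis .
qed

text \<open>This is the completeness of the theory of the free structure.\<close>

lemma free_theory_Neg: "\<phi> \<in> sentences (expand L n) \<Longrightarrow> Neg \<phi> \<in> free_theory L E n \<longleftrightarrow> \<phi> \<notin> free_theory L E n"
  by (simp add: free_theory_def sentences_def models_Neg)

text \<open>From right to left this is property (b) for the theory of \<open>F\<close>; from left to
  right, contraposed, it supplies a false closed instance of a false universal sentence.\<close>

lemma free_theory_All:
  assumes "wf_fm (expand L n) \<phi>" "free_vars \<phi> \<subseteq> {x}"
  shows "All x \<phi> \<in> free_theory L E n \<longleftrightarrow> (\<forall>t \<in> closed_terms (expand L n). inst_fm x t \<phi> \<in> free_theory L E n)"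
proof -
  have "All x \<phi> \<in> sentences (expand L n)" using assms by (auto simp: sentences_def)
  then show ?thesis
    using presented_models_All[OF assms(2)] inst_sentence[OF assms]
    by (simp add: free_theory_def free_structure_def)
qed

text \<open>A model of \<open>R'\<close> is also a model of \<open>R\<close>. With
  \<open>R = {}\<close> this carries equations true in \<open>F\<close> to every presented
  structure.\<close>

lemma follows_mono: "follows L E n R s t \<Longrightarrow> R \<subseteq> R' \<Longrightarrow> follows L E n R' s t"
  unfolding follows_def model_of_def by blast

section \<open>Counting presentations and comparing densities\<close>

lemma finite_presentations:
  assumes "\<And>l. finite {i \<in> A. len i = l}"
  shows "finite (presentations k A len s)"
proof -
  have "{i \<in> A. len i \<le> s} = (\<Union>l \<in> {..s}. {i \<in> A. len i = l})" by auto
  then have "finite {i \<in> A. len i \<le> s}" using assms by simp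
  moreover have "presentations k A len s \<subseteq> Pow {i \<in> A. len i \<le> s}"
    by (auto simp: presentations_def)
  ultimately show ?thesis by (meson finite_Pow_iff finite_subset)
qed

text \<open>By inclusion-exclusion, the density of \<open>W\<close> is at least the sum of those of
  \<open>P\<close> and \<open>Q\<close> minus 1, and it is at most 1; squeezing gives the
  limit.\<close>

lemma density_one_conj_mono:
  fixes X :: "nat \<Rightarrow> 'a set"
  assumes fin: "\<And>s. finite (X s)" and ne: "eventually (\<lambda>s. X s \<noteq> {}) sequentially"
    and P: "(\<lambda>s. real (card {R \<in> X s. P R}) / real (card (X s))) \<longlonglongrightarrow> 1"
    and Q: "(\<lambda>s. real (card {R \<in> X s. Q R}) / real (card (X s))) \<longlonglongrightarrow> 1"
    and imp: "\<And>s R. R \<in> X s \<Longrightarrow> P R \<Longrightarrow> Q R \<Longrightarrow> W R"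
  shows "(\<lambda>s. real (card {R \<in> X s. W R}) / real (card (X s))) \<longlonglongrightarrow> 1"
proof (rule tendsto_sandwich)
  let ?d = "\<lambda>P s. real (card {R \<in> X s. P R}) / real (card (X s))"
  show "(\<lambda>s. ?d P s + ?d Q s - 1) \<longlonglongrightarrow> 1"
    using tendsto_diff[OF tendsto_add[OF P Q] tendsto_const[of 1]] by simp
  show "eventually (\<lambda>s. ?d P s + ?d Q s - 1 \<le> ?d W s) sequentially"
    using ne
  proof eventually_elim
    case (elim s)
    \<comment> \<open>Positivity makes \<open>card (X s) / card (X s)\<close> equal to 1; division
      by zero would give 0.\<close>
    have pos: "card (X s) > 0" using elim fin by (simp add: card_gt_0_iff)
    have "card {R \<in> X s. P R} + card {R \<in> X s. Q R}
        = card ({R \<in> X s. P R} \<union> {R \<in> X s. Q R}) + card ({R \<in> X s. P R} \<inter> {R \<in> X s. Q R})"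
      using fin by (intro card_Un_Int) auto
    also have "\<dots> \<le> card (X s) + card {R \<in> X s. W R}"
      using fin imp by (intro add_mono card_mono) auto
    finally have "real (card {R \<in> X s. P R}) + real (card {R \<in> X s. Q R}) - real (card (X s))
        \<le> real (card {R \<in> X s. W R})" by linarith
    then have "(real (card {R \<in> X s. P R}) + real (card {R \<in> X s. Q R}) - real (card (X s)))
          / real (card (X s)) \<le> ?d W s"
      by (rule divide_right_mono) simp
    then show ?case using pos by (simp add: add_divide_distrib diff_divide_distrib)
  qed
  show "eventually (\<lambda>s. ?d W s \<le> 1) sequentially"
    using ne
  proof eventually_elim
    case (elim s)
    have "card {R \<in> X s. W R} \<le> card (X s)" using fin by (intro card_mono) auto
    then show ?case using elim fin by (simp add: divide_le_eq)
  qed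
qed (rule tendsto_const)

section \<open>Closure properties and consistency of the density-one sentences\<close>

context
  fixes L :: "'f lang"
    and E :: "(('f, nat) trm \<times> ('f, nat) trm) set"
    and n k :: nat
    and A :: "'f identity set"
    and len :: "'f identity \<Rightarrow> nat"
  assumes fin: "\<And>l. finite {i \<in> A. len i = l}"
    and ne: "eventually (\<lambda>s. presentations k A len s \<noteq> {}) sequentially"
begin

private abbreviation (input) "TF \<equiv> free_theory L E n"
private abbreviation (input) "S \<equiv> density_one_sentences L E n k A len"

lemma density_one_always:
  assumes "\<phi> \<in> sentences (expand L n)" "\<And>R. models (presented L E n R) \<phi>"
  shows "\<phi> \<in> S"
proof -
  have "eventually (\<lambda>s. real (card {R \<in> presentations k A len s. models (presented L E n R) \<phi>})
      / real (card (presentations k A len s)) = 1) sequentially"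
    using ne by eventually_elim (use assms finite_presentations[OF fin] in auto)
  then show ?thesis
    using assms(1) by (simp add: density_one_sentences_def has_limiting_density_def tendsto_eventually)
qed

text \<open>The density-one sentences are closed under consequences of two premises over all
  presented structures. For a single premise, the same sentence is supplied twice.\<close>

lemma density_one_consequence:
  assumes "\<phi> \<in> S" "\<psi> \<in> S" "\<chi> \<in> sentences (expand L n)"
    and "\<And>R. models (presented L E n R) \<phi> \<Longrightarrow> models (presented L E n R) \<psi>
      \<Longrightarrow> models (presented L E n R) \<chi>"
  shows "\<chi> \<in> S"
  using assms density_one_conj_mono[OF finite_presentations[OF fin] ne,
      of "\<lambda>R. models (presented L E n R) \<phi>" "\<lambda>R. models (presented L E n R) \<psi>"
        "\<lambda>R. models (presented L E n R) \<chi>"]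
  by (simp add: density_one_sentences_def has_limiting_density_def)

lemma density_one_consistent:
  assumes "\<phi> \<in> S"
  shows "Neg \<phi> \<notin> S"
proof
  assume "Neg \<phi> \<in> S"
  have "free_vars \<phi> = {}" using assms by (simp add: density_one_sentences_def sentences_def)
  \<comment> \<open>No structure satisfies both \<open>\<phi>\<close> and its negation, so
    \<open>False\<close> may serve as the common consequence; its density is constantly 0.\<close>
  then have "(\<lambda>s. real (card {R \<in> presentations k A len s. False})
      / real (card (presentations k A len s))) \<longlonglongrightarrow> 1"
    using density_one_conj_mono[OF finite_presentations[OF fin] ne, of "\<lambda>R. models (presented L E n R) \<phi>"
        "\<lambda>R. models (presented L E n R) (Neg \<phi>)" "\<lambda>R. False"] assms \<open>Neg \<phi> \<in> S\<close>
    by (auto simp: density_one_sentences_def has_limiting_density_def models_Neg)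
  then show False by (simp add: LIMSEQ_const_iff)
qed

lemma free_theory_subset_iff_eq: "TF \<subseteq> S \<longleftrightarrow> TF = S"
proof
  assume sub: "TF \<subseteq> S"
  have "\<phi> \<in> TF" if "\<phi> \<in> S" for \<phi>
    using sub density_one_consistent[OF that] free_theory_Neg[of \<phi>] that
    by (auto simp: density_one_sentences_def)
  with sub show "TF = S" by blast
qed simp

text \<open>Both implications are proved together because negation exchanges them.\<close>

lemma free_theory_decided_in_density_one:
  assumes a: "\<And>t t'. t \<in> closed_terms (expand L n) \<Longrightarrow> t' \<in> closed_terms (expand L n) \<Longrightarrow>
        Neg (Eq t t') \<in> TF \<Longrightarrow> Neg (Eq t t') \<in> S"
    and b: "\<And>x \<phi>. wf_fm (expand L n) \<phi> \<Longrightarrow> free_vars \<phi> \<subseteq> {x} \<Longrightarrow>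
        (\<And>t. t \<in> closed_terms (expand L n) \<Longrightarrow> inst_fm x t \<phi> \<in> S) \<Longrightarrow> All x \<phi> \<in> S"
    and "\<phi> \<in> sentences (expand L n)"
  shows "(\<phi> \<in> TF \<longrightarrow> \<phi> \<in> S) \<and> (\<phi> \<notin> TF \<longrightarrow> Neg \<phi> \<in> S)"
  using assms(3)
\<comment> \<open>Structural induction would not suffice: the quantifier case needs the hypothesis
  for closed instances of the body, which are not subformulas.\<close>
proof (induction \<phi> rule: measure_induct_rule[of complexity])
  case (less \<phi>)
  note sent = less.prems
  then have negsent: "Neg \<phi> \<in> sentences (expand L n)" by (simp add: sentences_def)
  show ?case
  proof (cases \<phi>)
    case (Eq s t)
    then have st: "s \<in> closed_terms (expand L n)" "t \<in> closed_terms (expand L n)"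
      using sent by (auto simp: sentences_def closed_terms_def)
    have "\<phi> \<in> S" if "\<phi> \<in> TF"
    proof (rule density_one_always[OF sent])
      fix R
      \<comment> \<open>An equation true in \<open>F\<close> is a consequence of the axioms alone,
        hence of the axioms with any \<open>R\<close>.\<close>
      have "follows L E n {} s t"
        using that st by (simp add: Eq free_theory_def free_structure_def presented_eq_iff)
      then have "follows L E n R s t" by (rule follows_mono) simp
      then show "models (presented L E n R) \<phi>" using st by (simp add: Eq presented_eq_iff)
    qed
    then show ?thesis using a[OF st] free_theory_Neg[OF sent] by (auto simp: Eq)
  next
    case (Neg \<psi>)
    have \<psi>: "\<psi> \<in> sentences (expand L n)" using sent by (simp add: Neg sentences_def)
    then have IH: "(\<psi> \<in> TF \<longrightarrow> \<psi> \<in> S) \<and> (\<psi> \<notin> TF \<longrightarrow> Neg \<psi> \<in> S)"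
      by (intro less.IH) (simp_all add: Neg)
    \<comment> \<open>Only the double negation needs an argument; if \<open>\<psi>\<close> fails in
      \<open>F\<close>, the induction hypothesis already says \<open>\<phi> \<in> S\<close>.\<close>
    have "Neg \<phi> \<in> S" if "\<psi> \<in> S"
      by (rule density_one_consequence[OF that that negsent])
        (use \<psi> in \<open>simp add: Neg models_Neg sentences_def\<close>)
    then show ?thesis using IH free_theory_Neg[OF \<psi>] by (auto simp: Neg)
  next
    case (And \<psi> \<chi>)
    have sents: "\<psi> \<in> sentences (expand L n)" "\<chi> \<in> sentences (expand L n)"
      using sent by (auto simp: And sentences_def)
    have IH1: "(\<psi> \<in> TF \<longrightarrow> \<psi> \<in> S) \<and> (\<psi> \<notin> TF \<longrightarrow> Neg \<psi> \<in> S)"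
      by (rule less.IH) (simp_all add: And sents)
    have IH2: "(\<chi> \<in> TF \<longrightarrow> \<chi> \<in> S) \<and> (\<chi> \<notin> TF \<longrightarrow> Neg \<chi> \<in> S)"
      by (rule less.IH) (simp_all add: And sents)
    have fv: "free_vars \<psi> = {}" "free_vars \<chi> = {}" "free_vars \<phi> = {}"
      using sents sent by (simp_all add: sentences_def)
    have "\<phi> \<in> S" if "\<psi> \<in> S" "\<chi> \<in> S"
      by (rule density_one_consequence[OF that sent]) (simp add: And models_And)
    \<comment> \<open>A conjunction false in \<open>F\<close> has a false conjunct, whose negation
      has density 1 and refutes the conjunction.\<close>
    moreover have "Neg \<phi> \<in> S" if "Neg \<psi> \<in> S"
      by (rule density_one_consequence[OF that that negsent])
        (use fv in \<open>simp add: models_Neg, simp add: And models_And\<close>)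
    moreover have "Neg \<phi> \<in> S" if "Neg \<chi> \<in> S"
      by (rule density_one_consequence[OF that that negsent])
        (use fv in \<open>simp add: models_Neg, simp add: And models_And\<close>)
    moreover have "\<phi> \<in> TF \<longleftrightarrow> \<psi> \<in> TF \<and> \<chi> \<in> TF"
      using sent sents by (auto simp: And free_theory_def models_And)
    ultimately show ?thesis using IH1 IH2 by blast
  next
    case (All x \<psi>)
    have \<psi>: "wf_fm (expand L n) \<psi>" "free_vars \<psi> \<subseteq> {x}"
      using sent by (auto simp: All sentences_def)
    have IH: "(inst_fm x t \<psi> \<in> TF \<longrightarrow> inst_fm x t \<psi> \<in> S)
        \<and> (inst_fm x t \<psi> \<notin> TF \<longrightarrow> Neg (inst_fm x t \<psi>) \<in> S)"
      if "t \<in> closed_terms (expand L n)" for t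
      by (rule less.IH) (simp_all add: All inst_sentence[OF \<psi> that])
    \<comment> \<open>One refuted closed instance refutes \<open>\<phi>\<close> in the same
      presented structure, so density 1 passes from the negated instance to
      \<open>Neg \<phi>\<close>.\<close>
    have "Neg \<phi> \<in> S"
      if t: "t \<in> closed_terms (expand L n)" and neg: "Neg (inst_fm x t \<psi>) \<in> S" for t
    proof (rule density_one_consequence[OF neg neg negsent])
      fix R
      assume "models (presented L E n R) (Neg (inst_fm x t \<psi>))"
      moreover have "free_vars (inst_fm x t \<psi>) = {}" "free_vars \<phi> = {}"
        using inst_sentence[OF \<psi> t] sent by (simp_all add: sentences_def)
      ultimately show "models (presented L E n R) (Neg \<phi>)"
        using t presented_models_All[OF \<psi>(2), of L E n R] by (auto simp: models_Neg All)
    qed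
    then show ?thesis
      using IH b[OF \<psi>] free_theory_All[OF \<psi>] unfolding All by blast
  qed
qed

end

section \<open>Equivalence of the three conditions\<close>

theorem proposition5p1:
  fixes L :: "'f lang"
    and E :: "(('f, nat) trm \<times> ('f, nat) trm) set"
    and n k :: nat
    and A :: "'f identity set"
    and len :: "'f identity \<Rightarrow> nat"
  assumes "E \<subseteq> identities L"
    and "A \<subseteq> closed_identities L n"
    and "\<And>l. finite {i \<in> A. len i = l}"
    and "eventually (\<lambda>s. presentations k A len s \<noteq> {}) sequentially"
  shows "let T\<^sub>F = free_theory L E n; S = density_one_sentences L E n k A len in
    (T\<^sub>F \<subseteq> S \<longleftrightarrow> T\<^sub>F = S) \<and>
    (T\<^sub>F = S \<longleftrightarrow>
      (\<forall>t \<in> closed_terms (expand L n). \<forall>t' \<in> closed_terms (expand L n).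
         Neg (Eq t t') \<in> T\<^sub>F \<longrightarrow> Neg (Eq t t') \<in> S) \<and>
      (\<forall>x \<phi>. wf_fm (expand L n) \<phi> \<and> free_vars \<phi> \<subseteq> {x} \<longrightarrow>
         (\<forall>t \<in> closed_terms (expand L n). inst_fm x t \<phi> \<in> S) \<longrightarrow> All x \<phi> \<in> S))"
proof -
  note fin = assms(3) and ne = assms(4)
  let ?T = "free_theory L E n" and ?S = "density_one_sentences L E n k A len"
  note sub = free_theory_subset_iff_eq[OF fin ne, where L = L and E = E and n = n]
  show ?thesis
    unfolding Let_def
  proof (intro conjI iffI)
    assume eq: "?T = ?S"
    show "\<forall>t \<in> closed_terms (expand L n). \<forall>t' \<in> closed_terms (expand L n).
        Neg (Eq t t') \<in> ?T \<longrightarrow> Neg (Eq t t') \<in> ?S"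
      using eq by simp
    \<comment> \<open>Rewriting \<open>S\<close> as the theory of \<open>F\<close> reduces (b) to
      the fact that \<open>F\<close> is generated by its closed terms.\<close>
    show "\<forall>x \<phi>. wf_fm (expand L n) \<phi> \<and> free_vars \<phi> \<subseteq> {x} \<longrightarrow>
        (\<forall>t \<in> closed_terms (expand L n). inst_fm x t \<phi> \<in> ?S) \<longrightarrow> All x \<phi> \<in> ?S"
      using free_theory_All[of L n _ _ E] unfolding eq[symmetric] by blast
  next
    assume ab: "(\<forall>t \<in> closed_terms (expand L n). \<forall>t' \<in> closed_terms (expand L n).
        Neg (Eq t t') \<in> ?T \<longrightarrow> Neg (Eq t t') \<in> ?S) \<and>
      (\<forall>x \<phi>. wf_fm (expand L n) \<phi> \<and> free_vars \<phi> \<subseteq> {x} \<longrightarrow>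
        (\<forall>t \<in> closed_terms (expand L n). inst_fm x t \<phi> \<in> ?S) \<longrightarrow> All x \<phi> \<in> ?S)"
    have "\<phi> \<in> ?S" if "\<phi> \<in> ?T" for \<phi>
    proof -
      have "\<phi> \<in> sentences (expand L n)" using that by (simp add: free_theory_def)
      then show ?thesis
        using free_theory_decided_in_density_one[OF fin ne, where L = L and E = E and n = n and \<phi> = \<phi>] ab that by blast
    qed
    then show "?T = ?S" using sub by blast
  qed (use sub in auto)
qed

end
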